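(* Let $n\in\mathbb{N}$, let $S_1,\ldots,S_n$ be pairwise disjoint finite semigroups, let $S$ be their zero-union, and let $\mathit{NC}=\{i\in\{1,\ldots,n\} : S_i \text{ is not commutative}\}$. Suppose that $|\mathit{NC}|\geqslant 2$. Then $$\chi(\mathcal{G}(S))=\sum_{i\in\mathit{NC}}\chi(\mathcal{G}(S_i)).$$
   Context: Zero-union: for pairwise disjoint semigroups $S_1,\ldots,S_n$, their zero-union is the set $\{0\}\cup\bigcup_{i=1}^n S_i$, where $0$ is a new element, and where the product of $x$ and $y$ is the element $xy\in S_i$ if $x,y\in S_i$ for some $i$, and is $0$ in all remaining cases. The center of a semigroup $T$ is $Z(T)=\{x\in T: xy=yx \text{ for all } y\in T\}$. For a finite non-commutative semigroup $T$, the commuting graph $\mathcal{G}(T)$ is the simple graph with vertex set $T\setminus Z(T)$ in which two distinct vertices $x,y$ are adjacent if and only if $xy=yx$. $\chi(G)$ denotes the chromatic number of a simple graph $G$ (the minimum number of colours needed to colour the vertices so that adjacent vertices have different colours). *)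

theory Defs
  imports "HOL-Algebra.Congruence" "HOL-Library.Disjoint_Sets" "Graph_Theory.Pair_Digraph"
begin

section \<open>Semigroups with an explicit carrier\<close>

record 'a sgrp = "'a partial_object" +
  smult :: "'a \<Rightarrow> 'a \<Rightarrow> 'a" (infixl \<open>\<cdot>\<index>\<close> 70)

text \<open>The carrier may be empty; an empty semigroup is commutative.\<close>

locale carrier_semigroup =
  fixes T :: "('a, 'm) sgrp_scheme" (structure)
  assumes closed: "\<lbrakk>x \<in> carrier T; y \<in> carrier T\<rbrakk> \<Longrightarrow> x \<cdot> y \<in> carrier T"
    and assoc: "\<lbrakk>x \<in> carrier T; y \<in> carrier T; z \<in> carrier T\<rbrakk> \<Longrightarrow> (x \<cdot> y) \<cdot> z = x \<cdot> (y \<cdot> z)"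

locale finite_carrier_semigroup = carrier_semigroup +
  assumes finite_carrier: "finite (carrier T)"

definition commutative :: "('a, 'm) sgrp_scheme \<Rightarrow> bool" where
  "commutative T \<longleftrightarrow> (\<forall>x\<in>carrier T. \<forall>y\<in>carrier T. x \<cdot>\<^bsub>T\<^esub> y = y \<cdot>\<^bsub>T\<^esub> x)"

definition semigroup_center :: "('a, 'm) sgrp_scheme \<Rightarrow> 'a set" where
  "semigroup_center T = {x \<in> carrier T. \<forall>y\<in>carrier T. x \<cdot>\<^bsub>T\<^esub> y = y \<cdot>\<^bsub>T\<^esub> x}"

section \<open>Zero-unions\<close>

text \<open>
  The members of the family are semigroups on subsets of a common type \<open>'a\<close>, each with its own
  multiplication. The new zero element is \<open>None\<close>, and \<open>x\<close> in some \<open>S i\<close> becomes \<open>Some x\<close>.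
  The index selected by \<open>THE\<close> is unique when the carriers are pairwise disjoint.
\<close>

definition zero_union_mult ::
  "'i set \<Rightarrow> ('i \<Rightarrow> ('a, 'm) sgrp_scheme) \<Rightarrow> 'a option \<Rightarrow> 'a option \<Rightarrow> 'a option" where
  "zero_union_mult I S u v =
     (case (u, v) of
        (Some x, Some y) \<Rightarrow>
          if \<exists>i\<in>I. x \<in> carrier (S i) \<and> y \<in> carrier (S i)
          then Some (x \<cdot>\<^bsub>S (THE i. i \<in> I \<and> x \<in> carrier (S i) \<and> y \<in> carrier (S i))\<^esub> y)
          else None
      | _ \<Rightarrow> None)"

definition zero_union :: "'i set \<Rightarrow> ('i \<Rightarrow> ('a, 'm) sgrp_scheme) \<Rightarrow> 'a option sgrp" where
  "zero_union I S =
     \<lparr> carrier = {None} \<union> Some ` (\<Union>i\<in>I. carrier (S i)), smult = zero_union_mult I S \<rparr>"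

section \<open>Commuting graphs and chromatic numbers\<close>

text \<open>A simple graph is a loop-free symmetric digraph; an edge is a pair of opposite arcs.\<close>

definition commuting_graph :: "('a, 'm) sgrp_scheme \<Rightarrow> 'a pair_pre_digraph" where
  "commuting_graph T =
     \<lparr> pverts = carrier T - semigroup_center T,
       parcs = {(x, y). x \<in> carrier T - semigroup_center T \<and> y \<in> carrier T - semigroup_center T \<and>
                        x \<noteq> y \<and> x \<cdot>\<^bsub>T\<^esub> y = y \<cdot>\<^bsub>T\<^esub> x} \<rparr>"

definition proper_colouring :: "'a pair_pre_digraph \<Rightarrow> nat \<Rightarrow> ('a \<Rightarrow> nat) \<Rightarrow> bool" where
  "proper_colouring G k c \<longleftrightarrow>
     (\<forall>v\<in>pverts G. c v < k) \<and> (\<forall>(u, v)\<in>parcs G. c u \<noteq> c v)"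

text \<open>
  For a finite graph the minimum is attained (lemma \<open>chromatic_number_attained\<close> below).
  The graph without vertices has chromatic number 0.
\<close>

definition chromatic_number :: "'a pair_pre_digraph \<Rightarrow> nat" where
  "chromatic_number G = (LEAST k. \<exists>c. proper_colouring G k c)"

section \<open>Basic properties of the definitions\<close>

lemma (in finite_carrier_semigroup) pair_graph_commuting_graph:
  "pair_graph (commuting_graph T)"
proof -
  have "parcs (commuting_graph T) \<subseteq> carrier T \<times> carrier T"
    by (auto simp: commuting_graph_def)
  then have "finite (parcs (commuting_graph T))"
    using finite_carrier finite_subset by blast
  then show ?thesis
    using finite_carrier
    by unfold_locales
      (auto simp: commuting_graph_def with_proj_def arcs_ends_def arc_to_ends_def
        symmetric_def sym_def)
qed

lemma chromatic_number_attained: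
  assumes "pair_graph G"
  shows "\<exists>c. proper_colouring G (chromatic_number G) c"
proof -
  interpret pair_graph G by fact
  obtain c :: "'a \<Rightarrow> nat" and n where c: "c ` pverts G = {i. i < n}" "inj_on c (pverts G)"
    using finite_imp_inj_to_nat_seg[OF pair_finite_verts] by blast
  have "proper_colouring G n c"
    unfolding proper_colouring_def
  proof (intro conjI ballI, goal_cases)
    case (1 v)
    then show ?case using c(1) by blast
  next
    case (2 e)
    then show ?case
      using inj_onD[OF c(2), of "fst e" "snd e"] arc_fst_in_verts[of e] arc_snd_in_verts[of e]
        pair_no_loops[of e] by (auto simp: case_prod_beta)
  qed
  then have "\<exists>k c. proper_colouring G k c" by blast
  then show ?thesis
    unfolding chromatic_number_def by (rule LeastI_ex)
qed

lemma zero_union_mult_None [simp]: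
  "zero_union_mult I S None v = None" "zero_union_mult I S u None = None"
  by (auto simp: zero_union_mult_def split: option.splits)

lemma zero_union_mult_same:
  assumes "disjoint_family_on (\<lambda>i. carrier (S i)) I"
    and "i \<in> I" "x \<in> carrier (S i)" "y \<in> carrier (S i)"
  shows "zero_union_mult I S (Some x) (Some y) = Some (x \<cdot>\<^bsub>S i\<^esub> y)"
proof -
  have "(THE j. j \<in> I \<and> x \<in> carrier (S j) \<and> y \<in> carrier (S j)) = i"
    using assms by (intro the_equality) (auto simp: disjoint_family_on_def)
  then show ?thesis
    using assms by (auto simp: zero_union_mult_def)
qed

lemma zero_union_mult_different:
  assumes "disjoint_family_on (\<lambda>i. carrier (S i)) I"
    and "i \<in> I" "j \<in> I" "i \<noteq> j" "x \<in> carrier (S i)" "y \<in> carrier (S j)"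
  shows "zero_union_mult I S (Some x) (Some y) = None"
proof -
  have "\<not> (\<exists>k\<in>I. x \<in> carrier (S k) \<and> y \<in> carrier (S k))"
    using assms unfolding disjoint_family_on_def by (metis disjoint_iff)
  then show ?thesis by (simp add: zero_union_mult_def)
qed

lemma finite_carrier_semigroup_zero_union:
  assumes I: "finite I" and S: "\<And>i. i \<in> I \<Longrightarrow> finite_carrier_semigroup (S i)"
    and disj: "disjoint_family_on (\<lambda>i. carrier (S i)) I"
  shows "finite_carrier_semigroup (zero_union I S)"
proof -
  let ?m = "zero_union_mult I S" and ?C = "carrier (zero_union I S)"
  have cl: "x \<cdot>\<^bsub>S i\<^esub> y \<in> carrier (S i)" if "i \<in> I" "x \<in> carrier (S i)" "y \<in> carrier (S i)" for i x y
    using S[OF that(1)] that carrier_semigroup.closed finite_carrier_semigroup.axioms(1) by metis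
  have as: "x \<cdot>\<^bsub>S i\<^esub> y \<cdot>\<^bsub>S i\<^esub> z = x \<cdot>\<^bsub>S i\<^esub> (y \<cdot>\<^bsub>S i\<^esub> z)"
    if "i \<in> I" "x \<in> carrier (S i)" "y \<in> carrier (S i)" "z \<in> carrier (S i)" for i x y z
    using S[OF that(1)] that carrier_semigroup.assoc finite_carrier_semigroup.axioms(1) by metis
  note same = zero_union_mult_same[where S = S, OF disj]
  note diff = zero_union_mult_different[where S = S, OF disj]
  have elim: "u = None \<or> (\<exists>i\<in>I. \<exists>x\<in>carrier (S i). u = Some x)" if "u \<in> ?C" for u
    using that by (auto simp: zero_union_def)
  have closed: "?m u v \<in> ?C" if uv: "u \<in> ?C" "v \<in> ?C" for u v
  proof (cases "u = None \<or> v = None")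
    case True
    then show ?thesis by (auto simp: zero_union_def)
  next
    case False
    then obtain i j x y where *: "i \<in> I" "x \<in> carrier (S i)" "u = Some x"
        "j \<in> I" "y \<in> carrier (S j)" "v = Some y"
      using elim[OF uv(1)] elim[OF uv(2)] by blast
    show ?thesis
    proof (cases "i = j")
      case True
      then show ?thesis using * same[of i x y] cl[of i x y] by (auto simp: zero_union_def)
    next
      case False
      then show ?thesis using * diff[of i j x y] by (auto simp: zero_union_def)
    qed
  qed
  have assoc: "?m (?m u v) w = ?m u (?m v w)" if uvw: "u \<in> ?C" "v \<in> ?C" "w \<in> ?C" for u v w
  proof (cases "u = None \<or> v = None \<or> w = None")
    case True
    then show ?thesis by auto
  next
    case False
    then obtain i j k x y z where *: "i \<in> I" "x \<in> carrier (S i)" "u = Some x"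
        "j \<in> I" "y \<in> carrier (S j)" "v = Some y" "k \<in> I" "z \<in> carrier (S k)" "w = Some z"
      using elim[OF uvw(1)] elim[OF uvw(2)] elim[OF uvw(3)] by blast
    show ?thesis
      using * same[of i x y] diff[of i j x y] same[of j y z] diff[of j k y z]
        same[of i "x \<cdot>\<^bsub>S i\<^esub> y" z] diff[of i k "x \<cdot>\<^bsub>S i\<^esub> y" z]
        same[of j x "y \<cdot>\<^bsub>S j\<^esub> z"] diff[of i j x "y \<cdot>\<^bsub>S j\<^esub> z"]
        cl[of i x y] cl[of j y z] as[of i x y z]
      by (cases "i = j"; cases "j = k") simp_all
  qed
  have "finite ?C"
    using I finite_carrier_semigroup.finite_carrier[OF S] by (simp add: zero_union_def)
  then show ?thesis
    using closed assoc by unfold_locales (simp_all add: zero_union_def)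
qed

end

theory Submission
  imports Defs
begin

text \<open>
  Elements of different components of a zero-union commute, both products being zero, and within
  one component the multiplication is the old one. Hence an element of a component is central in
  the zero-union exactly when it is central in its component, and the zero itself is central. The
  vertices that survive are therefore those of the commuting graphs of the components (none for a
  commutative component), and the commuting graph of the zero-union is the join of these graphs:
  their disjoint union, with all edges added between different parts (lemmas
  \<open>bij_betw_vertices_zero_union\<close> and \<open>commuting_graph_zero_union_arc_iff\<close>).

  The chromatic number is additive on joins (\<open>chromatic_number_join\<close>): in a proper colouring,
  different parts use disjoint sets of colours, and conversely proper colourings of the parts
  with disjoint sets of colours combine to a proper colouring of the join.
\<close>

section \<open>The chromatic number of a join\<close>

lemma chromatic_number_le:
  "proper_colouring G k c \<Longrightarrow> chromatic_number G \<le> k"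
  unfolding chromatic_number_def by (rule Least_le) blast

text \<open>
  Colours may be taken from any finite set. This spares the renumbering of colours by initial
  segments of the natural numbers, both when colourings of parts are combined and when a colouring
  is restricted to a part.
\<close>

lemma chromatic_number_le_card:
  assumes "pair_wf_digraph G" and "finite A"
    and range: "\<And>v. v \<in> pverts G \<Longrightarrow> c v \<in> A"
    and proper: "\<And>u v. (u, v) \<in> parcs G \<Longrightarrow> c u \<noteq> c v"
  shows "chromatic_number G \<le> card A"
proof -
  interpret pair_wf_digraph G by fact
  obtain h where h: "bij_betw h A {0..<card A}"
    using ex_bij_betw_finite_nat[OF \<open>finite A\<close>] by blast
  have "proper_colouring G (card A) (\<lambda>v. h (c v))"
    unfolding proper_colouring_def
  proof (intro conjI ballI)
    fix v assume "v \<in> pverts G"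
    then show "h (c v) < card A"
      using bij_betwE[OF h] range by auto
  next
    fix e assume e: "e \<in> parcs G"
    obtain u v where uv: "e = (u, v)" by fastforce
    have "u \<in> pverts G" "v \<in> pverts G"
      using e uv arc_fst_in_verts[of e] arc_snd_in_verts[of e] by auto
    then have "h (c u) \<noteq> h (c v)"
      using e uv proper range inj_onD[OF bij_betw_imp_inj_on[OF h]] by blast
    then show "case e of (u, v) \<Rightarrow> h (c u) \<noteq> h (c v)"
      by (simp add: uv)
  qed
  then show ?thesis by (rule chromatic_number_le)
qed

text \<open>
  The join is described up to isomorphism: \<open>f i\<close> embeds the part \<open>H i\<close> into \<open>G\<close>, and bijectivity on
  the dependent sum says that the images of the parts partition the vertices of \<open>G\<close>.
\<close>

lemma chromatic_number_join:
  fixes f :: "'i \<Rightarrow> 'a \<Rightarrow> 'b"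
  assumes J: "finite J"
    and H: "\<And>i. i \<in> J \<Longrightarrow> pair_graph (H i)"
    and G: "pair_graph G"
    and verts: "bij_betw (\<lambda>(i, x). f i x) (SIGMA i:J. pverts (H i)) (pverts G)"
    and arcs: "\<And>i j x y. \<lbrakk>i \<in> J; j \<in> J; x \<in> pverts (H i); y \<in> pverts (H j)\<rbrakk> \<Longrightarrow>
      (f i x, f j y) \<in> parcs G \<longleftrightarrow> i \<noteq> j \<or> (x, y) \<in> parcs (H i)"
  shows "chromatic_number G = (\<Sum>i\<in>J. chromatic_number (H i))"
proof (rule antisym)
  interpret G: pair_graph G by fact
  have vert_cases: "\<exists>i x. i \<in> J \<and> x \<in> pverts (H i) \<and> v = f i x" if "v \<in> pverts G" for v
    using that unfolding bij_betw_imp_surj_on[OF verts, symmetric] by auto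
  have vertI: "f i x \<in> pverts G" if "i \<in> J" "x \<in> pverts (H i)" for i x
    using that unfolding bij_betw_imp_surj_on[OF verts, symmetric] by force
  show "chromatic_number G \<le> (\<Sum>i\<in>J. chromatic_number (H i))"
  proof -
    define c where "c i = (SOME c. proper_colouring (H i) (chromatic_number (H i)) c)" for i
    have c: "proper_colouring (H i) (chromatic_number (H i)) (c i)" if "i \<in> J" for i
      unfolding c_def using chromatic_number_attained[OF H[OF that]] by (rule someI_ex)
    define A where "A = (SIGMA i:J. {..<chromatic_number (H i)})"
    define p where "p = inv_into (SIGMA i:J. pverts (H i)) (\<lambda>(i, x). f i x)"
    have p: "p (f i x) = (i, x)" if "i \<in> J" "x \<in> pverts (H i)" for i x
      using inv_into_f_f[OF bij_betw_imp_inj_on[OF verts], of "(i, x)"] that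
      by (simp add: p_def)
    \<comment> \<open>Tagging each colour with its part makes the colour sets of the parts disjoint.\<close>
    define d where "d v = (case p v of (i, x) \<Rightarrow> (i, c i x))" for v
    have d: "d (f i x) = (i, c i x)" if "i \<in> J" "x \<in> pverts (H i)" for i x
      using p[OF that] by (simp add: d_def)
    have "chromatic_number G \<le> card A"
    proof (rule chromatic_number_le_card)
      show "pair_wf_digraph G" by unfold_locales
      show "finite A" using J by (simp add: A_def)
    next
      fix v assume "v \<in> pverts G"
      then obtain i x where "i \<in> J" "x \<in> pverts (H i)" "v = f i x"
        using vert_cases by blast
      then show "d v \<in> A"
        using d c by (auto simp: A_def proper_colouring_def)
    next
      fix u v assume uv: "(u, v) \<in> parcs G"
      obtain i x where x: "i \<in> J" "x \<in> pverts (H i)" "u = f i x"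
        using vert_cases G.arc_fst_in_verts[OF uv] by fastforce
      obtain j y where y: "j \<in> J" "y \<in> pverts (H j)" "v = f j y"
        using vert_cases G.arc_snd_in_verts[OF uv] by fastforce
      have "i \<noteq> j \<or> (x, y) \<in> parcs (H i)"
        using arcs[of i j x y] uv x y by blast
      then show "d u \<noteq> d v"
        using c[OF x(1)] x y d by (auto simp: proper_colouring_def)
    qed
    then show ?thesis
      using J by (simp add: A_def card_SigmaI)
  qed
  show "(\<Sum>i\<in>J. chromatic_number (H i)) \<le> chromatic_number G"
  proof -
    obtain c where c: "proper_colouring G (chromatic_number G) c"
      using chromatic_number_attained[OF G] by blast
    have proper: "c u \<noteq> c v" if "(u, v) \<in> parcs G" for u v
      using c that by (auto simp: proper_colouring_def)
    define B where "B i = (\<lambda>x. c (f i x)) ` pverts (H i)" for i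
    have fin: "finite (B i)" if "i \<in> J" for i
    proof -
      interpret Hi: pair_graph "H i" using H[OF that] .
      show ?thesis by (simp add: B_def)
    qed
    have le: "chromatic_number (H i) \<le> card (B i)" if i: "i \<in> J" for i
    proof -
      interpret Hi: pair_graph "H i" using H[OF i] .
      show ?thesis
      proof (rule chromatic_number_le_card[where c = "\<lambda>x. c (f i x)"])
        show "pair_wf_digraph (H i)" by unfold_locales
        show "finite (B i)" using fin[OF i] .
        show "c (f i x) \<in> B i" if "x \<in> pverts (H i)" for x
          using that by (simp add: B_def)
        show "c (f i x) \<noteq> c (f i y)" if "(x, y) \<in> parcs (H i)" for x y
          using proper arcs[OF i i, of x y] that
            Hi.arc_fst_in_verts[OF that] Hi.arc_snd_in_verts[OF that] by simp
      qed
    qed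
    have disj: "B i \<inter> B j = {}" if "i \<in> J" "j \<in> J" "i \<noteq> j" for i j
      using that proper arcs[of i j] by (fastforce simp: B_def)
    have "(\<Sum>i\<in>J. chromatic_number (H i)) \<le> (\<Sum>i\<in>J. card (B i))"
      by (rule sum_mono) (rule le)
    also have "\<dots> = card (\<Union>i\<in>J. B i)"
      using J fin disj by (intro card_UN_disjoint[symmetric]) auto
    also have "\<dots> \<le> card {..<chromatic_number G}"
      using c vertI by (intro card_mono) (auto simp: B_def proper_colouring_def)
    finally show ?thesis by simp
  qed
qed

section \<open>The commuting graph of a zero-union\<close>

lemma pverts_commuting_graph: "pverts (commuting_graph T) = carrier T - semigroup_center T"
  by (simp add: commuting_graph_def)

lemma parcs_commuting_graph_iff:
  assumes "x \<in> pverts (commuting_graph T)" "y \<in> pverts (commuting_graph T)"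
  shows "(x, y) \<in> parcs (commuting_graph T) \<longleftrightarrow> x \<noteq> y \<and> x \<cdot>\<^bsub>T\<^esub> y = y \<cdot>\<^bsub>T\<^esub> x"
  using assms by (simp add: commuting_graph_def)

lemma pverts_commuting_graph_empty_iff:
  "pverts (commuting_graph T) = {} \<longleftrightarrow> commutative T"
  by (auto simp: pverts_commuting_graph semigroup_center_def commutative_def)

context
  fixes I :: "'i set" and S :: "'i \<Rightarrow> ('a, 'm) sgrp_scheme"
  assumes disj: "disjoint_family_on (\<lambda>i. carrier (S i)) I"
begin

lemma zero_union_commute_iff:
  assumes "i \<in> I" "j \<in> I" "x \<in> carrier (S i)" "y \<in> carrier (S j)"
  shows "Some x \<cdot>\<^bsub>zero_union I S\<^esub> Some y = Some y \<cdot>\<^bsub>zero_union I S\<^esub> Some x \<longleftrightarrow>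
    i \<noteq> j \<or> x \<cdot>\<^bsub>S i\<^esub> y = y \<cdot>\<^bsub>S i\<^esub> x"
proof (cases "i = j")
  case True
  then show ?thesis
    using assms zero_union_mult_same[where S = S, OF disj, of i] by (simp add: zero_union_def)
next
  case False
  then show ?thesis
    using assms zero_union_mult_different[where S = S, OF disj] by (simp add: zero_union_def)
qed

lemma Some_in_semigroup_center_zero_union_iff:
  assumes i: "i \<in> I" and x: "x \<in> carrier (S i)"
  shows "Some x \<in> semigroup_center (zero_union I S) \<longleftrightarrow> x \<in> semigroup_center (S i)"
proof -
  have carrier: "carrier (zero_union I S) = {None} \<union> Some ` (\<Union>j\<in>I. carrier (S j))"
    by (simp add: zero_union_def)
  have "Some x \<cdot>\<^bsub>zero_union I S\<^esub> None = None \<cdot>\<^bsub>zero_union I S\<^esub> Some x"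
    by (simp add: zero_union_def)
  then have "Some x \<in> semigroup_center (zero_union I S) \<longleftrightarrow>
      (\<forall>j\<in>I. \<forall>y\<in>carrier (S j).
        Some x \<cdot>\<^bsub>zero_union I S\<^esub> Some y = Some y \<cdot>\<^bsub>zero_union I S\<^esub> Some x)"
    using i x by (auto simp: semigroup_center_def carrier)
  also have "\<dots> \<longleftrightarrow> (\<forall>j\<in>I. \<forall>y\<in>carrier (S j). i \<noteq> j \<or> x \<cdot>\<^bsub>S i\<^esub> y = y \<cdot>\<^bsub>S i\<^esub> x)"
    using zero_union_commute_iff[OF i _ x] by (intro ball_cong refl) blast
  also have "\<dots> \<longleftrightarrow> x \<in> semigroup_center (S i)"
    using i x by (auto simp: semigroup_center_def)
  finally show ?thesis .
qed

lemma pverts_commuting_graph_zero_union: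
  "pverts (commuting_graph (zero_union I S)) =
    Some ` (\<Union>i\<in>I. pverts (commuting_graph (S i)))"
proof -
  have "None \<in> semigroup_center (zero_union I S)"
    by (simp add: semigroup_center_def zero_union_def)
  then have "pverts (commuting_graph (zero_union I S)) =
      Some ` (\<Union>i\<in>I. carrier (S i)) - semigroup_center (zero_union I S)"
    by (auto simp: pverts_commuting_graph zero_union_def)
  also have "\<dots> = Some ` (\<Union>i\<in>I. carrier (S i) - semigroup_center (S i))"
    using Some_in_semigroup_center_zero_union_iff by auto
  finally show ?thesis by (simp add: pverts_commuting_graph)
qed

text \<open>Commutative components have no non-central elements, so only the others are indexed.\<close>

lemma bij_betw_vertices_zero_union:
  "bij_betw (\<lambda>(i, x). Some x)
    (SIGMA i:{i \<in> I. \<not> commutative (S i)}. pverts (commuting_graph (S i)))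
    (pverts (commuting_graph (zero_union I S)))"
  unfolding bij_betw_def
proof
  show "inj_on (\<lambda>(i, x). Some x)
      (SIGMA i:{i \<in> I. \<not> commutative (S i)}. pverts (commuting_graph (S i)))"
    using disj by (auto simp: inj_on_def pverts_commuting_graph disjoint_family_on_def)
  have "(\<lambda>(i, x). Some x) `
      (SIGMA i:{i \<in> I. \<not> commutative (S i)}. pverts (commuting_graph (S i))) =
      Some ` (\<Union>i\<in>{i \<in> I. \<not> commutative (S i)}. pverts (commuting_graph (S i)))"
    by force
  also have "(\<Union>i\<in>{i \<in> I. \<not> commutative (S i)}. pverts (commuting_graph (S i))) =
      (\<Union>i\<in>I. pverts (commuting_graph (S i)))"
    by (auto simp: pverts_commuting_graph_empty_iff[symmetric])
  finally show "(\<lambda>(i, x). Some x) `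
      (SIGMA i:{i \<in> I. \<not> commutative (S i)}. pverts (commuting_graph (S i))) =
      pverts (commuting_graph (zero_union I S))"
    by (simp add: pverts_commuting_graph_zero_union)
qed

lemma commuting_graph_zero_union_arc_iff:
  assumes i: "i \<in> I" and j: "j \<in> I"
    and x: "x \<in> pverts (commuting_graph (S i))" and y: "y \<in> pverts (commuting_graph (S j))"
  shows "(Some x, Some y) \<in> parcs (commuting_graph (zero_union I S)) \<longleftrightarrow>
    i \<noteq> j \<or> (x, y) \<in> parcs (commuting_graph (S i))"
proof -
  have verts: "Some x \<in> pverts (commuting_graph (zero_union I S))"
      "Some y \<in> pverts (commuting_graph (zero_union I S))"
    using assms by (auto simp: pverts_commuting_graph_zero_union)
  have xy: "x \<in> carrier (S i)" "y \<in> carrier (S j)"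
    using x y by (auto simp: pverts_commuting_graph)
  then have "x \<noteq> y" if "i \<noteq> j"
    using disj i j that by (auto simp: disjoint_family_on_def)
  then show ?thesis
    using zero_union_commute_iff[OF i j xy] parcs_commuting_graph_iff[OF verts]
      parcs_commuting_graph_iff[OF x, of y] y by auto
qed

end

theorem corollary3p5:
  fixes n :: nat and S :: "nat \<Rightarrow> 'a sgrp"
  assumes "\<And>i. i \<in> {1..n} \<Longrightarrow> finite_carrier_semigroup (S i)"
    and "disjoint_family_on (\<lambda>i. carrier (S i)) {1..n}"
    and "card {i \<in> {1..n}. \<not> commutative (S i)} \<ge> 2"
  shows "chromatic_number (commuting_graph (zero_union {1..n} S)) =
    (\<Sum>i | i \<in> {1..n} \<and> \<not> commutative (S i). chromatic_number (commuting_graph (S i)))"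
proof (rule chromatic_number_join[where f = "\<lambda>_. Some"])
  show "finite {i. i \<in> {1..n} \<and> \<not> commutative (S i)}" by simp
  show "pair_graph (commuting_graph (S i))"
    if "i \<in> {i. i \<in> {1..n} \<and> \<not> commutative (S i)}" for i
    using that assms(1) finite_carrier_semigroup.pair_graph_commuting_graph by blast
  show "pair_graph (commuting_graph (zero_union {1..n} S))"
    using assms(1,2) finite_carrier_semigroup_zero_union[of "{1..n}" S]
      finite_carrier_semigroup.pair_graph_commuting_graph by blast
qed (use bij_betw_vertices_zero_union[OF assms(2)]
    commuting_graph_zero_union_arc_iff[OF assms(2)] in auto)

end
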